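(* $\mathbf{GR}$ enjoys uniform interpolation property: for every $\mathcal{L}_2$-formula $A$ and every finite set $P$ of propositional variables there is an $\mathcal{L}_2$-formula $C$ such that (1) $v(C)\subseteq v(A)\setminus P$; (2) $\mathbf{GR}\vdash A\to C$; (3) for every $\mathcal{L}_2$-formula $B$, if $\mathbf{GR}\vdash A\to B$ and $v(B)\cap P=\emptyset$, then $\mathbf{GR}\vdash C\to B$.
   Context: $\mathcal{L}_2$ is the bimodal propositional language with countably many propositional variables, $\bot$, connectives $\neg,\vee$ (others defined), and unary modal operators $\Box,\blacksquare$; $\Diamond$ abbreviates $\neg\Box\neg$; $v(A)$ denotes the set of propositional variables occurring in $A$. The logic $\mathbf{GR}^-$ has as axioms all propositional tautologies of $\mathcal{L}_2$ and all instances of $\Box(A\to B)\to(\Box A\to\Box B)$, $\Box(\Box A\to A)\to\Box A$, $\blacksquare A\to\Box A$, $\Box A\to\Box\blacksquare A$, $\Box A\to(\Box\bot\vee\blacksquare A)$, $\Diamond\blacksquare A\to\Diamond A$, and rules modus ponens and $\Box$-necessitation. $\mathbf{GR}$ is $\mathbf{GR}^-$ plus the rule: from $\Box A$ infer $A$. *)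

theory Defs
  imports Main
begin

datatype fm =
    Var nat
  | Bot
  | Neg fm
  | Dis fm fm
  | Box fm
  | BBox fm

abbreviation Imp :: "fm \<Rightarrow> fm \<Rightarrow> fm" where
  "Imp A B \<equiv> Dis (Neg A) B"

abbreviation Dia :: "fm \<Rightarrow> fm" where
  "Dia A \<equiv> Neg (Box (Neg A))"

primrec vars :: "fm \<Rightarrow> nat set" where
  "vars (Var p) = {p}"
| "vars Bot = {}"
| "vars (Neg A) = vars A"
| "vars (Dis A B) = vars A \<union> vars B"
| "vars (Box A) = vars A"
| "vars (BBox A) = vars A"

text \<open>
  Boolean evaluation treats variables and all formulas beginning with a modal operator as
  propositional atoms, so that tautologies are exactly the substitution instances, in the
  bimodal language, of classical propositional tautologies.
\<close>

primrec bool_eval :: "(fm \<Rightarrow> bool) \<Rightarrow> fm \<Rightarrow> bool" where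
  "bool_eval g (Var p) = g (Var p)"
| "bool_eval g Bot = False"
| "bool_eval g (Neg A) = (\<not> bool_eval g A)"
| "bool_eval g (Dis A B) = (bool_eval g A \<or> bool_eval g B)"
| "bool_eval g (Box A) = g (Box A)"
| "bool_eval g (BBox A) = g (BBox A)"

definition tautology :: "fm \<Rightarrow> bool" where
  "tautology A \<longleftrightarrow> (\<forall>g. bool_eval g A)"

inductive GR_minus :: "fm \<Rightarrow> bool" where
  Taut: "tautology A \<Longrightarrow> GR_minus A"
| K: "GR_minus (Imp (Box (Imp A B)) (Imp (Box A) (Box B)))"
| Loeb: "GR_minus (Imp (Box (Imp (Box A) A)) (Box A))"
| BBox_Box: "GR_minus (Imp (BBox A) (Box A))"
| Box_Box_BBox: "GR_minus (Imp (Box A) (Box (BBox A)))"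
| Box_BBox: "GR_minus (Imp (Box A) (Dis (Box Bot) (BBox A)))"
| Dia_BBox: "GR_minus (Imp (Dia (BBox A)) (Dia A))"
| MP: "GR_minus (Imp A B) \<Longrightarrow> GR_minus A \<Longrightarrow> GR_minus B"
| Nec: "GR_minus A \<Longrightarrow> GR_minus (Box A)"

inductive GR :: "fm \<Rightarrow> bool" where
  Minus: "GR_minus A \<Longrightarrow> GR A"
| MP: "GR (Imp A B) \<Longrightarrow> GR A \<Longrightarrow> GR B"
| Nec: "GR A \<Longrightarrow> GR (Box A)"
| Box_elim: "GR (Box A) \<Longrightarrow> GR A"

end

theory Submission
  imports Defs
begin

text \<open>
  \<^bold>\<open>GR\<close> is sound and complete for finite transitive trees in which \<open>BBox D\<close> means \<open>Box D\<close> at inner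
  nodes and is evaluated freely at leaves, except that a leaf above a node \<open>s\<close> must
  agree with \<open>D\<close> whenever \<open>D\<close> has a constant truth value above \<open>s\<close>; the rule \<open>Box A / A\<close> says
  that only nodes having a predecessor count. The uniform interpolant of \<open>A\<close> is the disjunction of
  the \<open>P\<close>-free characteristic formulas of sufficiently large modal depth that are consistent with
  \<open>A\<close>. It is uniform by Visser's layered bisimulation argument: a model of \<open>A\<close> and a model of
  \<open>\<not> B\<close> which agree on \<open>P\<close>-free formulas of that depth can be amalgamated into one tree that is
  \<open>P\<close>-free equivalent to the second and agrees with the first on the subformulas of \<open>A\<close>. At the
  leaves of the amalgam, formulas \<open>BBox D\<close> controlled by neither model copy the value of \<open>D\<close>,
  which satisfies the Rosser constraints for free.
\<close>

section \<open>Tree models\<close>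

text \<open>\<open>rosser_set\<close> is consulted only at leaves, where it lists the
  \<open>D\<close> with \<open>BBox D\<close> true. List-valued children make every tree
  finite.\<close>

datatype tree = Node (val: "nat set") (rosser_set: "fm set") (children: "tree list")

primrec desc :: "tree \<Rightarrow> tree set" where
  "desc (Node V R ts) = \<Union> (set (map (\<lambda>t. insert t (desc t)) ts))"

lemma desc_Node [simp]: "desc (Node V R ts) = (\<Union>t\<in>set ts. insert t (desc t))"
  by simp

declare desc.simps [simp del]

lemma finite_desc: "finite (desc t)"
  by (induct t) auto

lemma desc_trans: "u \<in> desc t \<Longrightarrow> v \<in> desc u \<Longrightarrow> v \<in> desc t"
  by (induct t) fastforce

lemma size_desc: "u \<in> desc t \<Longrightarrow> size u < size t"
proof (induct t)
  case (Node V R ts)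
  then obtain t where t: "t \<in> set ts" "u = t \<or> u \<in> desc t" by auto
  then have "size u \<le> size t" using Node.hyps[of t] by auto
  also have "size t < size (Node V R ts)"
    using size_list_estimation'[OF t(1), of "size t" size] by simp
  finally show ?case .
qed

text \<open>The axioms \<open>BBox_Box\<close> and \<open>Box_BBox\<close> make
  \<open>BBox A\<close> and \<open>Box A\<close> equivalent wherever \<open>Box Bot\<close> fails;
  hence the collapse at inner nodes.\<close>

primrec sat :: "tree \<Rightarrow> fm \<Rightarrow> bool" (infix "\<Turnstile>" 50) where
  "t \<Turnstile> Var p \<longleftrightarrow> p \<in> val t"
| "t \<Turnstile> Bot \<longleftrightarrow> False"
| "t \<Turnstile> Neg A \<longleftrightarrow> \<not> t \<Turnstile> A"
| "t \<Turnstile> Dis A B \<longleftrightarrow> t \<Turnstile> A \<or> t \<Turnstile> B"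
| "t \<Turnstile> Box A \<longleftrightarrow> (\<forall>u\<in>desc t. u \<Turnstile> A)"
| "t \<Turnstile> BBox A \<longleftrightarrow> (if desc t = {} then A \<in> rosser_set t else \<forall>u\<in>desc t. u \<Turnstile> A)"

lemma sat_Box_desc: "t \<Turnstile> Box A \<Longrightarrow> u \<in> desc t \<Longrightarrow> u \<Turnstile> Box A"
  using desc_trans by auto

text \<open>A smallest descendant refuting \<open>A\<close> works, because size drops along
  \<open>desc\<close>.\<close>

lemma sat_Loeb:
  assumes "\<not> t \<Turnstile> Box A"
  obtains u where "u \<in> desc t" "\<not> u \<Turnstile> A" "u \<Turnstile> Box A"
proof -
  let ?Q = "\<lambda>u. u \<in> desc t \<and> \<not> u \<Turnstile> A"
  obtain u0 where "?Q u0" using assms by auto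
  then obtain u where u: "?Q u" "\<And>v. ?Q v \<Longrightarrow> size u \<le> size v"
    using ex_has_least_nat[of ?Q u0 size] by blast
  have "u \<Turnstile> Box A" using u desc_trans size_desc by (fastforce simp: not_less[symmetric])
  then show thesis using that u(1) by blast
qed

text \<open>Semantic forms of \<open>Box_Box_BBox\<close> and of the contraposed
  \<open>Dia_BBox\<close>. They constrain the descendants of \<open>t\<close>, never
  \<open>t\<close> itself.\<close>

definition rosser :: "tree \<Rightarrow> fm \<Rightarrow> bool" where
  "rosser t D \<longleftrightarrow> (t \<Turnstile> Box D \<longrightarrow> t \<Turnstile> Box (BBox D)) \<and>
                  (t \<Turnstile> Box (Neg D) \<longrightarrow> t \<Turnstile> Box (Neg (BBox D)))"

definition good :: "tree \<Rightarrow> bool" where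
  "good t \<longleftrightarrow> (\<forall>u\<in>insert t (desc t). \<forall>D. rosser u D)"

lemma good_rosser: "good t \<Longrightarrow> rosser t D"
  by (simp add: good_def)

lemma good_desc: "good t \<Longrightarrow> u \<in> desc t \<Longrightarrow> good u"
  using desc_trans by (auto simp: good_def)

lemma good_Node:
  assumes "\<And>t. t \<in> set ts \<Longrightarrow> good t" and "\<And>D. rosser (Node V R ts) D"
  shows "good (Node V R ts)"
  using assms unfolding good_def by auto

text \<open>At inner children \<open>BBox\<close> is \<open>Box\<close>, and nodes further up are
  covered by goodness of the child, so only leaf children leave an obligation.\<close>

lemma rosser_Node:
  assumes "\<And>t. t \<in> set ts \<Longrightarrow> good t"
    and leaf1: "\<And>t. t \<in> set ts \<Longrightarrow> desc t = {} \<Longrightarrow> Node V R ts \<Turnstile> Box D \<Longrightarrow> t \<Turnstile> BBox D"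
    and leaf2: "\<And>t. t \<in> set ts \<Longrightarrow> desc t = {} \<Longrightarrow> Node V R ts \<Turnstile> Box (Neg D) \<Longrightarrow> \<not> t \<Turnstile> BBox D"
  shows "rosser (Node V R ts) D"
proof -
  have 1: "u \<Turnstile> BBox D"
    if D: "Node V R ts \<Turnstile> Box D" and t: "t \<in> set ts" and u: "u \<in> insert t (desc t)" for t u
  proof -
    have "t \<Turnstile> Box D" using D t by auto
    then have "t \<Turnstile> Box (BBox D)" using good_rosser[OF assms(1)[OF t]] by (auto simp: rosser_def)
    then have "u \<in> desc t \<Longrightarrow> ?thesis" by (metis sat.simps(5))
    moreover have "t \<Turnstile> BBox D" using leaf1[OF t _ D] \<open>t \<Turnstile> Box D\<close> by auto
    ultimately show ?thesis using u by blast
  qed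
  have 2: "\<not> u \<Turnstile> BBox D"
    if D: "Node V R ts \<Turnstile> Box (Neg D)" and t: "t \<in> set ts" and u: "u \<in> insert t (desc t)" for t u
  proof -
    have "t \<Turnstile> Box (Neg D)" using D t by auto
    then have "t \<Turnstile> Box (Neg (BBox D))"
      using good_rosser[OF assms(1)[OF t]] unfolding rosser_def by blast
    then have "u \<in> desc t \<Longrightarrow> ?thesis" by (metis sat.simps(3,5))
    moreover have "\<not> t \<Turnstile> BBox D" using leaf2[OF t _ D] \<open>t \<Turnstile> Box (Neg D)\<close> by auto
    ultimately show ?thesis using u by blast
  qed
  from 1 have "Node V R ts \<Turnstile> Box D \<Longrightarrow> Node V R ts \<Turnstile> Box (BBox D)"
    by (simp only: sat.simps(5) desc_Node) blast
  moreover from 2 have "Node V R ts \<Turnstile> Box (Neg D) \<Longrightarrow> Node V R ts \<Turnstile> Box (Neg (BBox D))"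
    by (simp only: sat.simps(3,5) desc_Node) blast
  ultimately show ?thesis unfolding rosser_def by blast
qed

section \<open>Soundness\<close>

lemma bool_eval_sat: "bool_eval (sat t) A \<longleftrightarrow> t \<Turnstile> A"
  by (induct A) auto

lemma GR_minus_sound: "GR_minus A \<Longrightarrow> good t \<Longrightarrow> t \<Turnstile> A"
proof (induct arbitrary: t rule: GR_minus.induct)
  case (Taut A)
  then show ?case using bool_eval_sat[of t A] by (simp add: tautology_def)
next
  case (Loeb A)
  show ?case using sat_Loeb[of t A] by (metis sat.simps(3-5))
next
  case (Box_Box_BBox A)
  then show ?case using good_rosser[of t A] unfolding rosser_def by (metis sat.simps(3,4))
next
  case (Dia_BBox A)
  then show ?case using good_rosser[of t A] unfolding rosser_def by (metis sat.simps(3,4))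
next
  case (Nec A)
  then show ?case using good_desc by auto
qed auto

text \<open>The invariant is \<open>Box A\<close> rather than \<open>A\<close>, since a conclusion
  of \<open>Box_elim\<close> may fail at a root.\<close>

lemma GR_sound: "GR A \<Longrightarrow> good s \<Longrightarrow> s \<Turnstile> Box A"
proof (induct arbitrary: s rule: GR.induct)
  case (Minus A)
  then show ?case using GR_minus_sound good_desc by auto
next
  case (Nec A)
  then show ?case using desc_trans by auto
next
  case (Box_elim A)
  show ?case
  proof (cases "desc s = {}")
    case False
    \<comment> \<open>A new root is put below \<open>s\<close>, where the induction hypothesis
      yields \<open>Box (Box A)\<close>. As \<open>s\<close> is not a leaf,
      \<open>rosser_Node\<close> imposes nothing on it.\<close>
    have "good (Node {} {} [s])"
      using Box_elim.prems False by (intro good_Node rosser_Node) auto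
    from Box_elim.hyps(2)[OF this] show ?thesis by simp
  qed simp
qed auto

section \<open>Fragments and leaves\<close>

text \<open>\<open>Box Bot\<close> distinguishes leaves from inner nodes. \<open>BBox_S\<close>
  supplies the boxed formulas of \<open>rosser t D\<close>, so truth on \<open>S\<close> settles
  that condition whenever \<open>BBox D\<close> is in \<open>S\<close>.\<close>

locale fragment =
  fixes S :: "fm set"
  assumes finite_S: "finite S"
    and Box_Bot: "Box Bot \<in> S"
    and Neg_S: "Neg A \<in> S \<Longrightarrow> A \<in> S"
    and Dis_S: "Dis A B \<in> S \<Longrightarrow> A \<in> S \<and> B \<in> S"
    and Box_S: "Box A \<in> S \<Longrightarrow> A \<in> S"
    and BBox_S: "BBox A \<in> S \<Longrightarrow> {A, Box A, Box (BBox A), Box (Neg A), Box (Neg (BBox A))} \<subseteq> S"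

primrec closure :: "fm \<Rightarrow> fm set" where
  "closure (Var p) = {Var p, Bot, Box Bot}"
| "closure Bot = {Bot, Box Bot}"
| "closure (Neg A) = insert (Neg A) (closure A)"
| "closure (Dis A B) = insert (Dis A B) (closure A \<union> closure B)"
| "closure (Box A) = insert (Box A) (closure A)"
| "closure (BBox A) = {BBox A, Box A, Box (BBox A), Neg A, Box (Neg A), Neg (BBox A),
     Box (Neg (BBox A))} \<union> closure A"

lemma closure_refl [simp]: "A \<in> closure A"
  by (cases A) auto

lemma vars_closure: "B \<in> closure A \<Longrightarrow> vars B \<subseteq> vars A"
  by (induct A) auto

lemma fragment_closure: "fragment (closure A)"
proof
  show "finite (closure A)" "Box Bot \<in> closure A" by (induct A) auto
  show "B \<in> closure A" if "Neg B \<in> closure A" for B using that by (induct A) auto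
  show "B \<in> closure A \<and> C \<in> closure A" if "Dis B C \<in> closure A" for B C
    using that by (induct A) auto
  show "B \<in> closure A" if "Box B \<in> closure A" for B using that by (induct A) auto
  show "{B, Box B, Box (BBox B), Box (Neg B), Box (Neg (BBox B))} \<subseteq> closure A"
    if "BBox B \<in> closure A" for B using that by (induct A) auto
qed

definition default_outside :: "fm set \<Rightarrow> tree \<Rightarrow> bool" where
  "default_outside K t \<longleftrightarrow>
     (\<forall>u\<in>insert t (desc t). \<forall>D. desc u = {} \<longrightarrow> D \<notin> K \<longrightarrow> (u \<Turnstile> BBox D \<longleftrightarrow> u \<Turnstile> D))"

lemma default_outside_Node:
  assumes "\<And>t. t \<in> set ts \<Longrightarrow> default_outside K t"
    and "\<And>D. ts = [] \<Longrightarrow> D \<notin> K \<Longrightarrow> D \<in> R \<longleftrightarrow> Node V R ts \<Turnstile> D"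
  shows "default_outside K (Node V R ts)"
proof -
  have "desc (Node V R ts) = {} \<Longrightarrow> ts = []" by (cases ts) auto
  then show ?thesis using assms unfolding default_outside_def by auto
qed

text \<open>If \<open>D\<close> is constant above \<open>t\<close>, leaves copy that constant into
  \<open>BBox D\<close>, and inner nodes compute the same constant through
  \<open>Box D\<close>.\<close>

lemma default_outside_rosser:
  assumes "default_outside K t" "D \<notin> K"
  shows "rosser t D"
proof -
  have *: "desc u = {} \<Longrightarrow> u \<Turnstile> BBox D \<longleftrightarrow> u \<Turnstile> D" if "u \<in> desc t" for u
    using assms that unfolding default_outside_def by blast
  have 1: "u \<Turnstile> BBox D" if "t \<Turnstile> Box D" "u \<in> desc t" for u
    using * sat_Box_desc[of t D u] that by (cases "desc u = {}") auto
  have 2: "\<not> u \<Turnstile> BBox D" if "t \<Turnstile> Box (Neg D)" "u \<in> desc t" for u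
    using * sat_Box_desc[of t "Neg D" u] that by (cases "desc u = {}") auto
  show ?thesis unfolding rosser_def using 1 2 by (metis sat.simps(3,5))
qed

primrec leaf_sat :: "nat set \<Rightarrow> fm set \<Rightarrow> fm set \<Rightarrow> fm \<Rightarrow> bool" where
  "leaf_sat V K R (Var p) \<longleftrightarrow> p \<in> V"
| "leaf_sat V K R Bot \<longleftrightarrow> False"
| "leaf_sat V K R (Neg A) \<longleftrightarrow> \<not> leaf_sat V K R A"
| "leaf_sat V K R (Dis A B) \<longleftrightarrow> leaf_sat V K R A \<or> leaf_sat V K R B"
| "leaf_sat V K R (Box A) \<longleftrightarrow> True"
| "leaf_sat V K R (BBox A) \<longleftrightarrow> (if A \<in> K then A \<in> R else leaf_sat V K R A)"

text \<open>The equation is circular, as \<open>R'\<close> occurs in the tree too.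
  \<open>leaf_sat\<close> solves it by recursion on formulas: outside \<open>K\<close>,
  \<open>BBox A\<close> depends only on the smaller \<open>A\<close>.\<close>

lemma leaf_extension:
  obtains R' where "\<And>D. D \<in> R' \<longleftrightarrow> (if D \<in> K then D \<in> R else Node V R' [] \<Turnstile> D)"
proof -
  define R' where "R' = {D. leaf_sat V K R (BBox D)}"
  have "Node V R' [] \<Turnstile> D \<longleftrightarrow> leaf_sat V K R D" for D
    by (induct D) (auto simp: R'_def)
  then show thesis using that[of R'] by (auto simp: R'_def)
qed

section \<open>Completeness\<close>

lemma GR_taut: "tautology A \<Longrightarrow> GR A"
  by (intro GR.Minus GR_minus.Taut)

lemma GR_taut1: "GR A \<Longrightarrow> tautology (Imp A B) \<Longrightarrow> GR B"
  using GR.MP GR_taut by blast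

lemma GR_taut2: "GR A \<Longrightarrow> GR B \<Longrightarrow> tautology (Imp A (Imp B C)) \<Longrightarrow> GR C"
  using GR.MP GR_taut by blast

lemma GR_taut3: "GR A \<Longrightarrow> GR B \<Longrightarrow> GR C \<Longrightarrow> tautology (Imp A (Imp B (Imp C D))) \<Longrightarrow> GR D"
  using GR.MP GR_taut by blast

abbreviation Con :: "fm \<Rightarrow> fm \<Rightarrow> fm" where
  "Con A B \<equiv> Neg (Dis (Neg A) (Neg B))"

lemma GR_Box_mono: "GR (Imp A B) \<Longrightarrow> GR (Imp (Box A) (Box B))"
  using GR.MP GR.Nec GR.Minus GR_minus.K by blast

lemma GR_Box_Con: "GR (Imp (Box A) (Imp (Box B) (Box (Con A B))))"
proof -
  have "GR (Imp (Box A) (Box (Imp B (Con A B))))"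
    by (intro GR_Box_mono GR_taut) (auto simp: tautology_def)
  from GR_taut2[OF this GR.Minus[OF GR_minus.K[of B "Con A B"]]]
  show ?thesis by (auto simp: tautology_def)
qed

lemma GR_4: "GR (Imp (Box A) (Box (Box A)))"
proof -
  have "GR (Imp (Box (BBox A)) (Box (Box A)))"
    by (intro GR_Box_mono GR.Minus GR_minus.BBox_Box)
  from GR_taut2[OF GR.Minus[OF GR_minus.Box_Box_BBox[of A]] this]
  show ?thesis by (auto simp: tautology_def)
qed

text \<open>\<open>X\<close> is the conjunction of all \<open>C\<close> and \<open>Box C\<close>;
  boxing the parts \<open>Box C\<close> under \<open>w\<close> uses \<open>GR_4\<close>.\<close>

lemma GR_boxed_premises:
  assumes "finite F" "\<And>C. C \<in> F \<Longrightarrow> GR (Imp w (Box C))"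
  shows "\<exists>X. GR (Imp w (Box X)) \<and> (\<forall>C\<in>F. GR (Imp X C) \<and> GR (Imp X (Box C)))"
  using assms
proof (induct F rule: finite_induct)
  case empty
  have "GR (Box (Neg Bot))" by (intro GR.Nec GR_taut) (auto simp: tautology_def)
  then have "GR (Imp w (Box (Neg Bot)))" by (rule GR_taut1) (auto simp: tautology_def)
  then show ?case by blast
next
  case (insert C F)
  then obtain X where X: "GR (Imp w (Box X))" "\<forall>C\<in>F. GR (Imp X C) \<and> GR (Imp X (Box C))"
    by auto
  let ?Y = "Con C (Box C)"
  have C: "GR (Imp w (Box C))" using insert by auto
  have "GR (Imp w (Box (Box C)))"
    by (rule GR_taut2[OF C GR_4[of C]]) (auto simp: tautology_def)
  then have Y: "GR (Imp w (Box ?Y))"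
    by (rule GR_taut3[OF C _ GR_Box_Con[of C "Box C"]]) (auto simp: tautology_def)
  have "GR (Imp w (Box (Con X ?Y)))"
    by (rule GR_taut3[OF X(1) Y GR_Box_Con[of X ?Y]]) (auto simp: tautology_def)
  moreover have "GR (Imp (Con X ?Y) E) \<and> GR (Imp (Con X ?Y) (Box E))" if "E \<in> insert C F" for E
  proof (cases "E = C")
    case True
    then show ?thesis by (auto intro!: GR_taut simp: tautology_def)
  next
    case False
    then have E: "GR (Imp X E)" "GR (Imp X (Box E))" using X(2) that by auto
    show ?thesis
      using GR_taut1[OF E(1), of "Imp (Con X ?Y) E"] GR_taut1[OF E(2), of "Imp (Con X ?Y) (Box E)"]
      by (auto simp: tautology_def)
  qed
  ultimately show ?case by blast
qed

definition consistent :: "fm \<Rightarrow> bool" where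
  "consistent A \<longleftrightarrow> \<not> GR (Neg A)"

lemma consistent_deciding_extension:
  assumes "finite F" "consistent w"
  shows "\<exists>w'. consistent w' \<and> GR (Imp w' w) \<and> (\<forall>B\<in>F. GR (Imp w' B) \<or> GR (Imp w' (Neg B)))"
  using assms
proof (induct F rule: finite_induct)
  case empty
  have "GR (Imp w w)" by (intro GR_taut) (auto simp: tautology_def)
  then show ?case using empty by auto
next
  case (insert B F)
  then obtain w1 where w1: "consistent w1" "GR (Imp w1 w)"
    "\<forall>B\<in>F. GR (Imp w1 B) \<or> GR (Imp w1 (Neg B))" by auto
  have "consistent (Con w1 B) \<or> consistent (Con w1 (Neg B))"
  proof (rule ccontr)
    assume "\<not> ?thesis"
    then have "GR (Neg (Con w1 B))" "GR (Neg (Con w1 (Neg B)))" by (auto simp: consistent_def)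
    then have "GR (Neg w1)" by (rule GR_taut2) (auto simp: tautology_def)
    then show False using w1(1) by (simp add: consistent_def)
  qed
  then obtain B' where B': "B' = B \<or> B' = Neg B" "consistent (Con w1 B')" by blast
  have weaken: "GR (Imp (Con w1 B') E)" if "GR (Imp w1 E)" for E
    using that by (rule GR_taut1) (auto simp: tautology_def)
  have "GR (Imp (Con w1 B') B')" by (intro GR_taut) (auto simp: tautology_def)
  then show ?case using w1 B' weaken by (intro exI[of _ "Con w1 B'"]) auto
qed

section \<open>Canonical worlds over a finite fragment\<close>

context fragment
begin

definition world :: "fm \<Rightarrow> bool" where
  "world w \<longleftrightarrow> consistent w \<and> (\<forall>B\<in>S. GR (Imp w B) \<or> GR (Imp w (Neg B)))"

lemma world_Neg: "world w \<Longrightarrow> B \<in> S \<Longrightarrow> GR (Imp w (Neg B)) \<longleftrightarrow> \<not> GR (Imp w B)"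
proof -
  assume w: "world w" "B \<in> S"
  have "GR (Neg w)" if "GR (Imp w (Neg B))" "GR (Imp w B)"
    using that by (rule GR_taut2) (auto simp: tautology_def)
  then show ?thesis using w by (auto simp: world_def consistent_def)
qed

lemma world_mp: "GR (Imp w A) \<Longrightarrow> GR (Imp A B) \<Longrightarrow> GR (Imp w B)"
  using GR_taut2[of "Imp w A" "Imp A B" "Imp w B"] by (auto simp: tautology_def)

lemma world_Dis:
  assumes "world w" "Dis A B \<in> S"
  shows "GR (Imp w (Dis A B)) \<longleftrightarrow> GR (Imp w A) \<or> GR (Imp w B)"
proof -
  have "GR (Imp A (Dis A B))" "GR (Imp B (Dis A B))"
    by (auto intro!: GR_taut simp: tautology_def)
  moreover have "GR (Imp w B)" if "GR (Imp w (Dis A B))" "GR (Imp w (Neg A))"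
    using that by (rule GR_taut2) (auto simp: tautology_def)
  ultimately show ?thesis using assms world_Neg[of w A] Dis_S world_mp by metis
qed

text \<open>The demands for successors refuting \<open>B\<close>; their number is the induction
  measure of \<open>truth_lemma\<close>.\<close>

definition unboxed :: "fm \<Rightarrow> fm set" where
  "unboxed w = {B. Box B \<in> S \<and> \<not> GR (Imp w (Box B))}"

lemma finite_Box_S: "finite {B. Box B \<in> S}"
  by (rule finite_surj[OF finite_S, of _ "\<lambda>A. case A of Box B \<Rightarrow> B | _ \<Rightarrow> Bot"])
     (force intro: rev_image_eqI)

text \<open>If \<open>X\<close>, \<open>Box B\<close> and \<open>Neg B\<close> were jointly
  inconsistent, \<open>w\<close> would imply \<open>Box (Imp (Box B) B)\<close> and so
  \<open>Box B\<close> by Loeb's axiom. Having \<open>Box B\<close> in \<open>u\<close> takes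
  \<open>B\<close> out of \<open>unboxed u\<close>.\<close>

lemma world_successor:
  assumes w: "world w" and B: "B \<in> unboxed w"
  obtains u where "world u" "GR (Imp u (Neg B))" "GR (Imp u (Box B))"
    "\<And>C. Box C \<in> S \<Longrightarrow> GR (Imp w (Box C)) \<Longrightarrow> GR (Imp u C) \<and> GR (Imp u (Box C))"
proof -
  let ?F = "{C. Box C \<in> S \<and> GR (Imp w (Box C))}"
  have "finite ?F" using finite_Box_S by simp
  from GR_boxed_premises[OF this, of w] obtain X
    where X: "GR (Imp w (Box X))" "\<forall>C\<in>?F. GR (Imp X C) \<and> GR (Imp X (Box C))" by auto
  let ?v = "Con X (Con (Box B) (Neg B))"
  have "consistent ?v"
  proof (rule ccontr)
    assume "\<not> ?thesis"
    then have "GR (Neg ?v)" by (simp add: consistent_def)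
    then have "GR (Imp X (Imp (Box B) B))" by (rule GR_taut1) (auto simp: tautology_def)
    from GR_taut3[OF X(1) GR_Box_mono[OF this] GR.Minus[OF GR_minus.Loeb[of B]], of "Imp w (Box B)"]
    have "GR (Imp w (Box B))" by (auto simp: tautology_def)
    then show False using B by (simp add: unboxed_def)
  qed
  from consistent_deciding_extension[OF finite_S this] obtain u
    where u: "world u" "GR (Imp u ?v)" by (auto simp: world_def)
  have uX: "GR (Imp u X)" by (rule GR_taut1[OF u(2)]) (auto simp: tautology_def)
  show thesis
  proof (rule that[OF u(1)])
    show "GR (Imp u (Neg B))" "GR (Imp u (Box B))"
      by (rule GR_taut1[OF u(2)], auto simp: tautology_def)+
  qed (use X(2) world_mp[OF uX] in blast)
qed

lemma world_rosser:
  assumes w: "world w" and t: "\<And>A. A \<in> S \<Longrightarrow> t \<Turnstile> A \<longleftrightarrow> GR (Imp w A)" and D: "BBox D \<in> S"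
  shows "rosser t D"
proof -
  have "GR (Imp (Dia (BBox D)) (Dia D))" by (intro GR.Minus GR_minus.Dia_BBox)
  then have "GR (Imp (Box (Neg D)) (Box (Neg (BBox D))))"
    by (rule GR_taut1) (auto simp: tautology_def)
  moreover have "GR (Imp (Box D) (Box (BBox D)))" by (intro GR.Minus GR_minus.Box_Box_BBox)
  moreover have "Box D \<in> S" "Box (Neg D) \<in> S" "Box (BBox D) \<in> S" "Box (Neg (BBox D)) \<in> S"
    using BBox_S[OF D] by auto
  ultimately show ?thesis unfolding rosser_def using t world_mp by blast
qed

lemma truth_lemma:
  assumes "world w"
  shows "\<exists>t. (\<forall>A\<in>S. t \<Turnstile> A \<longleftrightarrow> GR (Imp w A)) \<and> default_outside {D. BBox D \<in> S} t \<and> good t"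
  using assms
proof (induct "card (unboxed w)" arbitrary: w rule: less_induct)
  case less
  let ?K = "{D. BBox D \<in> S}"
  note w = \<open>world w\<close>
  have fin: "finite (unboxed w)" using finite_Box_S by (simp add: unboxed_def)
  have "\<exists>t. (\<not> t \<Turnstile> B) \<and> (\<forall>C. Box C \<in> S \<longrightarrow> GR (Imp w (Box C)) \<longrightarrow> t \<Turnstile> C \<and> t \<Turnstile> Box C) \<and>
         default_outside ?K t \<and> good t" if B: "B \<in> unboxed w" for B
  proof -
    obtain u where u: "world u" "GR (Imp u (Neg B))" "GR (Imp u (Box B))"
      "\<And>C. Box C \<in> S \<Longrightarrow> GR (Imp w (Box C)) \<Longrightarrow> GR (Imp u C) \<and> GR (Imp u (Box C))"
      using world_successor[OF w B] by metis
    have "unboxed u \<subset> unboxed w" using u(3,4) B by (auto simp: unboxed_def)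
    from less.hyps[OF psubset_card_mono[OF fin this] u(1)] obtain t
      where t: "\<forall>A\<in>S. t \<Turnstile> A \<longleftrightarrow> GR (Imp u A)" "default_outside ?K t" "good t" by blast
    have "B \<in> S" using B Box_S by (auto simp: unboxed_def)
    then have "\<not> t \<Turnstile> B" using t(1) u(2) world_Neg[OF u(1)] by blast
    then show ?thesis using t u(4) Box_S by blast
  qed
  then obtain f where f: "\<And>B. B \<in> unboxed w \<Longrightarrow> \<not> f B \<Turnstile> B \<and>
      (\<forall>C. Box C \<in> S \<longrightarrow> GR (Imp w (Box C)) \<longrightarrow> f B \<Turnstile> C \<and> f B \<Turnstile> Box C) \<and>
      default_outside ?K (f B) \<and> good (f B)" by metis
  obtain ts where ts: "set ts = f ` unboxed w" using finite_list[of "f ` unboxed w"] fin by auto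
  define V where "V = {p. GR (Imp w (Var p))}"
  \<comment> \<open>For \<open>BBox D\<close> in \<open>S\<close> the leaf value is read off from
    \<open>w\<close>; every other \<open>BBox D\<close> copies \<open>D\<close>.\<close>
  obtain R where R: "\<And>D. D \<in> R \<longleftrightarrow>
      (if D \<in> ?K then D \<in> {D. GR (Imp w (BBox D))} else Node V R [] \<Turnstile> D)"
    using leaf_extension[where V = V and K = ?K and R = "{D. GR (Imp w (BBox D))}"] by metis
  define t where "t = Node V R ts"
  have Box: "t \<Turnstile> Box C \<longleftrightarrow> GR (Imp w (Box C))" if C: "Box C \<in> S" for C
  proof
    assume "t \<Turnstile> Box C"
    then show "GR (Imp w (Box C))"
      using f[of C] ts C by (auto simp: t_def unboxed_def)
  next
    assume "GR (Imp w (Box C))"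
    then show "t \<Turnstile> Box C" using f ts C by (auto simp: t_def)
  qed
  have leaf: "desc t = {} \<longleftrightarrow> GR (Imp w (Box Bot))" using Box[OF Box_Bot] by auto
  have truth: "t \<Turnstile> A \<longleftrightarrow> GR (Imp w A)" if "A \<in> S" for A
    using that
  proof (induct A)
    case (Var p)
    then show ?case by (simp add: t_def V_def)
  next
    case Bot
    have "GR (Neg w)" if "GR (Imp w Bot)" using that by (rule GR_taut1) (auto simp: tautology_def)
    then show ?case using w by (auto simp: world_def consistent_def)
  next
    case (Neg A)
    then show ?case using world_Neg[OF w] Neg_S[of A] by auto
  next
    case (Dis A B)
    then show ?case using world_Dis[OF w] Dis_S[of A B] by auto
  next
    case (Box A)
    then show ?case using \<open>\<And>C. Box C \<in> S \<Longrightarrow> _\<close> by blast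
  next
    case (BBox D)
    show ?case
    proof (cases "desc t = {}")
      case True
      then show ?thesis using R[of D] BBox.prems by (simp add: t_def)
    next
      case False
      \<comment> \<open>Since \<open>w\<close> refutes \<open>Box Bot\<close>, the axioms make
        \<open>BBox D\<close> and \<open>Box D\<close> equivalent under \<open>w\<close>, as at an
        inner node.\<close>
      then have *: "GR (Imp w (Neg (Box Bot)))" using leaf world_Neg[OF w Box_Bot] by blast
      have "GR (Imp w (BBox D)) \<longleftrightarrow> GR (Imp w (Box D))"
      proof
        assume "GR (Imp w (BBox D))"
        then show "GR (Imp w (Box D))" using world_mp GR.Minus GR_minus.BBox_Box by blast
      next
        assume "GR (Imp w (Box D))"
        then show "GR (Imp w (BBox D))"
          by (rule GR_taut3[OF * _ GR.Minus[OF GR_minus.Box_BBox[of D]]])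
             (auto simp: tautology_def)
      qed
      then show ?thesis using False \<open>\<And>C. Box C \<in> S \<Longrightarrow> _\<close>[of D] BBox_S[OF BBox.prems] by auto
    qed
  qed
  have dflt: "default_outside ?K t"
    unfolding t_def by (rule default_outside_Node) (use f ts R in auto)
  have "rosser t D" for D
    using world_rosser[OF w truth] default_outside_rosser[OF dflt] by blast
  then have "good t" unfolding t_def by (intro good_Node) (use f ts in auto)
  then show ?case using truth dflt by blast
qed

end

text \<open>By \<open>Box_elim\<close>, an unprovable \<open>A\<close> has \<open>Box A\<close>
  unprovable as well; a root refuting \<open>Box A\<close> has a descendant refuting
  \<open>A\<close>, which is a node with a predecessor.\<close>

lemma GR_complete:
  assumes "\<And>s t. good s \<Longrightarrow> t \<in> desc s \<Longrightarrow> t \<Turnstile> A"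
  shows "GR A"
proof (rule ccontr)
  assume "\<not> GR A"
  then have "\<not> GR (Box A)" using GR.Box_elim by blast
  interpret fragment "closure (Box A)" by (rule fragment_closure)
  have "consistent (Neg (Box A))"
    using \<open>\<not> GR (Box A)\<close> GR_taut1[of "Neg (Neg (Box A))" "Box A"]
    by (auto simp: consistent_def tautology_def)
  from consistent_deciding_extension[OF finite_S this] obtain w
    where w: "world w" "GR (Imp w (Neg (Box A)))" unfolding world_def by blast
  from truth_lemma[OF w(1)] obtain s
    where s: "\<forall>B\<in>closure (Box A). s \<Turnstile> B \<longleftrightarrow> GR (Imp w B)" "good s" by blast
  have "\<not> s \<Turnstile> Box A" using s(1) w world_Neg[OF w(1)] closure_refl by blast
  then show False using assms s(2) by auto
qed

section \<open>Layers of characteristic formulas\<close>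

text \<open>State descriptions: conjunctions deciding every formula of the list.\<close>

fun descriptions :: "fm list \<Rightarrow> fm list" where
  "descriptions [] = [Neg Bot]"
| "descriptions (A # As) =
     map (Con A) (descriptions As) @ map (Con (Neg A)) (descriptions As)"

lemma descriptions_complete: "\<exists>c\<in>set (descriptions As). t \<Turnstile> c"
proof (induct As)
  case (Cons A As)
  then obtain c where "c \<in> set (descriptions As)" "t \<Turnstile> c" by blast
  then show ?case
    by (intro bexI[of _ "if t \<Turnstile> A then Con A c else Con (Neg A) c"]) auto
qed simp

lemma descriptions_determine:
  "c \<in> set (descriptions As) \<Longrightarrow> t \<Turnstile> c \<Longrightarrow> u \<Turnstile> c \<Longrightarrow> A \<in> set As \<Longrightarrow> t \<Turnstile> A \<longleftrightarrow> u \<Turnstile> A"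
  by (induct As arbitrary: c) auto

lemma vars_descriptions: "c \<in> set (descriptions As) \<Longrightarrow> vars c \<subseteq> \<Union> (vars ` set As)"
  by (induct As arbitrary: c) fastforce+

text \<open>Each layer adds which descriptions over the previous one occur among the descendants.
  Agreement on layer \<open>n\<close> amounts to \<open>n\<close>-round bisimilarity with
  \<open>As\<close> as atoms.\<close>

fun layer :: "fm list \<Rightarrow> nat \<Rightarrow> fm list" where
  "layer As 0 = As"
| "layer As (Suc n) = layer As n @ map Dia (descriptions (layer As n))"

lemma vars_layer: "B \<in> set (layer As n) \<Longrightarrow> vars B \<subseteq> \<Union> (vars ` set As)"
  by (induct n arbitrary: B) (auto dest!: vars_descriptions, blast+)

definition layer_equiv :: "fm list \<Rightarrow> nat \<Rightarrow> tree \<Rightarrow> tree \<Rightarrow> bool" where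
  "layer_equiv As n t u \<longleftrightarrow> (\<forall>A\<in>set (layer As n). t \<Turnstile> A \<longleftrightarrow> u \<Turnstile> A)"

lemma layer_equiv_sym: "layer_equiv As n t u \<Longrightarrow> layer_equiv As n u t"
  by (auto simp: layer_equiv_def)

lemma layer_equiv_mono: "m \<le> n \<Longrightarrow> layer_equiv As n t u \<Longrightarrow> layer_equiv As m t u"
  by (induct n rule: dec_induct) (auto simp: layer_equiv_def)

lemma layer_equiv_step:
  assumes "layer_equiv As (Suc n) t u" "t' \<in> desc t"
  obtains u' where "u' \<in> desc u" "layer_equiv As n t' u'"
proof -
  obtain c where c: "c \<in> set (descriptions (layer As n))" "t' \<Turnstile> c"
    using descriptions_complete by blast
  have "Dia c \<in> set (layer As (Suc n))" using c(1) by simp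
  moreover have "t \<Turnstile> Dia c" using c(2) assms(2) by auto
  ultimately have "u \<Turnstile> Dia c" using assms(1) unfolding layer_equiv_def by blast
  then obtain u' where "u' \<in> desc u" "u' \<Turnstile> c" by auto
  then show thesis
    using that descriptions_determine[OF c] by (auto simp: layer_equiv_def)
qed

section \<open>Amalgamation\<close>

text \<open>Layers start from all \<open>P\<close>-free members of \<open>S\<close>, not just
  variables, so layer 0 already compares leafhood, via \<open>Box Bot\<close>, and the
  \<open>P\<close>-free \<open>BBox\<close> formulas of \<open>S\<close>.\<close>

locale interpolation = fragment +
  fixes P :: "nat set" and As :: "fm list"
  assumes set_As: "set As = {A \<in> S. vars A \<inter> P = {}}"
begin

abbreviation controlled :: "fm set" where
  "controlled \<equiv> {D. vars D \<inter> P = {} \<or> BBox D \<in> S}"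

text \<open>The semantic counterpart of \<open>unboxed\<close>; its cardinality bounds how often a
  layer has to be spent.\<close>

definition failing :: "tree \<Rightarrow> fm set" where
  "failing t = {B. Box B \<in> S \<and> \<not> t \<Turnstile> Box B}"

lemma finite_failing: "finite (failing t)"
  using finite_Box_S by (simp add: failing_def)

lemma failing_desc: "u \<in> desc t \<Longrightarrow> failing u \<subseteq> failing t"
  unfolding failing_def using sat_Box_desc by blast

lemma layer_equiv_atoms:
  "layer_equiv As n x y \<Longrightarrow> A \<in> S \<Longrightarrow> vars A \<inter> P = {} \<Longrightarrow> x \<Turnstile> A \<longleftrightarrow> y \<Turnstile> A"
  using layer_equiv_mono[of 0 n As x y] set_As by (auto simp: layer_equiv_def)

text \<open>Asymmetric: \<open>P\<close>-free formulas of every depth follow \<open>x\<close>, while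
  only members of \<open>S\<close> follow \<open>y\<close>.\<close>

definition amalgam :: "tree \<Rightarrow> tree \<Rightarrow> tree \<Rightarrow> bool" where
  "amalgam x y z \<longleftrightarrow> (\<forall>A. vars A \<inter> P = {} \<longrightarrow> (z \<Turnstile> A \<longleftrightarrow> x \<Turnstile> A)) \<and>
     (\<forall>A\<in>S. z \<Turnstile> A \<longleftrightarrow> y \<Turnstile> A) \<and> default_outside controlled z \<and> good z"

text \<open>
  The node \<open>y'\<close> is Visser's witness: descendants of \<open>x\<close> are matched above \<open>y'\<close> rather than above
  \<open>y\<close>, so that no layer is lost as long as \<open>failing\<close> does not shrink. Once it shrinks, two
  layers have been gained.
\<close>

lemma amalgamation:
  assumes "good x" "good y'" "y = y' \<or> y \<in> desc y'" "failing y = failing y'"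
    and "layer_equiv As (2 * card (failing y)) x y"
    and "\<And>x1. x1 \<in> desc x \<Longrightarrow> \<exists>y1\<in>desc y'. layer_equiv As (2 * card (failing y)) x1 y1"
  shows "\<exists>z. amalgam x y z"
  using assms
proof (induct x arbitrary: y y' rule: measure_induct_rule[of size])
  case (less x)
  note prems = less.prems
  let ?d = "card (failing y)"
  have good_y: "good y" using prems(2,3) good_desc by blast
  have sub: "desc y \<subseteq> desc y'" using prems(3) desc_trans by blast
  \<comment> \<open>Here \<open>2 * ?d - 1\<close> is at least
    \<open>2 * card (failing y1) + 1\<close>. The spare layer matches descendants of
    \<open>x1\<close> above \<open>y1\<close>, which becomes its own witness.\<close>
  have smaller: "\<exists>z. amalgam x1 y1 z"
    if x1: "x1 \<in> desc x" and y1: "y1 \<in> desc y'" and lt: "card (failing y1) < ?d"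
      and eq: "layer_equiv As (2 * ?d - 1) x1 y1" for x1 y1
  proof (rule less.hyps[OF size_desc[OF x1]])
    have eq1: "layer_equiv As (Suc (2 * card (failing y1))) x1 y1"
      using eq by (rule layer_equiv_mono[rotated]) (use lt in linarith)
    show "good x1" "good y1" using x1 y1 prems good_desc by blast+
    show "layer_equiv As (2 * card (failing y1)) x1 y1"
      using eq1 by (rule layer_equiv_mono[rotated]) simp
    show "\<exists>y2\<in>desc y1. layer_equiv As (2 * card (failing y1)) x2 y2" if "x2 \<in> desc x1" for x2
      using layer_equiv_step[OF eq1 that] by blast
  qed auto
  have zig: "\<exists>z y1. y1 \<in> desc y' \<and> amalgam x1 y1 z" if x1: "x1 \<in> desc x" for x1
  proof -
    obtain y1 where y1: "y1 \<in> desc y'" "layer_equiv As (2 * ?d) x1 y1" using prems(6)[OF x1] by blast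
    have sub1: "failing y1 \<subseteq> failing y" using failing_desc[OF y1(1)] prems(4) by simp
    show ?thesis
    proof (cases "failing y1 = failing y")
      case True
      \<comment> \<open>The witness \<open>y'\<close> is kept: descendants of \<open>x1\<close> are
        descendants of \<open>x\<close>, hence already matched above \<open>y'\<close> at the same
        layer.\<close>
      have "\<exists>z. amalgam x1 y1 z"
      proof (rule less.hyps[OF size_desc[OF x1]])
        show "good x1" using x1 prems good_desc by blast
        show "\<exists>y2\<in>desc y'. layer_equiv As (2 * card (failing y1)) x2 y2" if "x2 \<in> desc x1" for x2
          using prems(6)[OF desc_trans[OF x1 that]] True by simp
      qed (use y1 prems True in auto)
      then show ?thesis using y1 by blast
    next
      case False
      then have "card (failing y1) < ?d"
        using sub1 finite_failing by (simp add: psubset_card_mono psubsetI)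
      then show ?thesis
        using smaller[OF x1 y1(1)] layer_equiv_mono[OF _ y1(2), of "2 * ?d - 1"] y1(1) by auto
    qed
  qed
  have zag: "\<exists>z x1 y1. x1 \<in> desc x \<and> y1 \<in> desc y' \<and> \<not> y1 \<Turnstile> B \<and> amalgam x1 y1 z"
    if B: "B \<in> failing y" for B
  proof -
    \<comment> \<open>Choosing \<open>y1\<close> with \<open>Box B\<close> true makes
      \<open>failing\<close> drop strictly, which pays for the layer spent in crossing from
      \<open>y\<close> to \<open>x\<close>.\<close>
    obtain y1 where y1: "y1 \<in> desc y" "\<not> y1 \<Turnstile> B" "y1 \<Turnstile> Box B"
      using sat_Loeb[of y B] B unfolding failing_def by blast
    have "B \<notin> failing y1" using y1(3) by (simp add: failing_def)
    then have "failing y1 \<subset> failing y" using failing_desc[OF y1(1)] B by blast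
    then have lt: "card (failing y1) < ?d" using finite_failing by (rule psubset_card_mono[rotated])
    have "layer_equiv As (Suc (2 * ?d - 1)) y x"
      using layer_equiv_sym[OF prems(5)] lt by simp
    from layer_equiv_step[OF this y1(1)] obtain x1
      where x1: "x1 \<in> desc x" "layer_equiv As (2 * ?d - 1) y1 x1" by blast
    show ?thesis using smaller[OF x1(1) _ lt layer_equiv_sym[OF x1(2)]] x1 y1 sub by blast
  qed
  obtain f where f: "\<And>x1. x1 \<in> desc x \<Longrightarrow> \<exists>y1. y1 \<in> desc y' \<and> amalgam x1 y1 (f x1)"
    using zig by metis
  obtain g where g: "\<And>B. B \<in> failing y \<Longrightarrow>
      \<exists>x1 y1. x1 \<in> desc x \<and> y1 \<in> desc y' \<and> \<not> y1 \<Turnstile> B \<and> amalgam x1 y1 (g B)"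
    using zag by metis
  obtain ts where ts: "set ts = f ` desc x \<union> g ` failing y"
    using finite_list[of "f ` desc x \<union> g ` failing y"] finite_desc finite_failing by auto
  have child: "\<exists>x1 y1. x1 \<in> desc x \<and> y1 \<in> desc y' \<and> amalgam x1 y1 t" if "t \<in> set ts" for t
    using that f g unfolding ts by blast
  \<comment> \<open>\<open>P\<close>-free data come from \<open>x\<close>, the rest from
    \<open>y\<close>. Where both must be respected the formula is a \<open>P\<close>-free member of
    \<open>S\<close>, on which \<open>x\<close> and \<open>y\<close> agree.\<close>
  define V where "V = (val x - P) \<union> (val y \<inter> P)"
  define R0 where "R0 = {D. if vars D \<inter> P = {} then x \<Turnstile> BBox D else y \<Turnstile> BBox D}"
  obtain R where R: "\<And>D. D \<in> R \<longleftrightarrow> (if D \<in> controlled then D \<in> R0 else Node V R [] \<Turnstile> D)"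
    using leaf_extension[where V = V and K = controlled and R = R0] by metis
  define z where "z = Node V R ts"
  have leaf_xy: "desc x = {} \<longleftrightarrow> desc y = {}"
    using layer_equiv_atoms[OF prems(5) Box_Bot] by auto
  have leaf: "desc z = {} \<longleftrightarrow> desc x = {}"
  proof
    show "desc z = {}" if "desc x = {}" using child that by (cases ts) (auto simp: z_def)
  qed (use ts in \<open>auto simp: z_def\<close>)
  have Box_free: "z \<Turnstile> Box A \<longleftrightarrow> x \<Turnstile> Box A" if A: "vars A \<inter> P = {}" for A
  proof
    assume "z \<Turnstile> Box A"
    then have "f x1 \<Turnstile> A" if "x1 \<in> desc x" for x1 using that ts by (auto simp: z_def)
    then show "x \<Turnstile> Box A" using f A unfolding amalgam_def by (metis sat.simps(5))
  next
    assume xA: "x \<Turnstile> Box A"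
    have "t \<Turnstile> A \<and> t \<Turnstile> Box A" if t: "t \<in> set ts" for t
    proof -
      obtain x1 y1 where "x1 \<in> desc x" "amalgam x1 y1 t" using child[OF t] by blast
      moreover have "x1 \<Turnstile> A \<and> x1 \<Turnstile> Box A" using xA \<open>x1 \<in> desc x\<close> sat_Box_desc by auto
      moreover have "vars (Box A) \<inter> P = {}" using A by simp
      ultimately show ?thesis using A unfolding amalgam_def by blast
    qed
    then show "z \<Turnstile> Box A" by (auto simp: z_def)
  qed
  have free: "z \<Turnstile> A \<longleftrightarrow> x \<Turnstile> A" if "vars A \<inter> P = {}" for A
    using that
  proof (induct A)
    case (Box A)
    then show ?case using Box_free by simp
  next
    case (BBox A)
    show ?case
    proof (cases "desc x = {}")
      case True
      then show ?thesis using leaf R[of A] BBox.prems by (simp add: z_def R0_def)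
    next
      case False
      then show ?thesis using leaf Box_free[of A] BBox.prems by simp
    qed
  qed (auto simp: z_def V_def Int_Un_distrib2)
  have Box_S': "z \<Turnstile> Box A \<longleftrightarrow> y \<Turnstile> Box A" if A: "Box A \<in> S" for A
  proof
    assume zA: "z \<Turnstile> Box A"
    show "y \<Turnstile> Box A"
    proof (rule ccontr)
      assume "\<not> y \<Turnstile> Box A"
      then have B: "A \<in> failing y" using A by (simp add: failing_def)
      then have "\<not> g A \<Turnstile> A" using g[OF B] Box_S[OF A] unfolding amalgam_def by blast
      moreover have "g A \<Turnstile> A" using zA B ts by (auto simp: z_def)
      ultimately show False by blast
    qed
  next
    assume "y \<Turnstile> Box A"
    \<comment> \<open>The children match nodes above \<open>y'\<close>, perhaps not above
      \<open>y\<close>; equality of the \<open>failing\<close> sets transfers \<open>Box A\<close>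
      to \<open>y'\<close>.\<close>
    then have yA: "y' \<Turnstile> Box A" using prems(4) A unfolding failing_def by blast
    have "t \<Turnstile> A \<and> t \<Turnstile> Box A" if t: "t \<in> set ts" for t
    proof -
      obtain x1 y1 where "y1 \<in> desc y'" "amalgam x1 y1 t" using child[OF t] by blast
      moreover have "y1 \<Turnstile> A \<and> y1 \<Turnstile> Box A" using yA \<open>y1 \<in> desc y'\<close> sat_Box_desc by auto
      ultimately show ?thesis using A Box_S[OF A] unfolding amalgam_def by blast
    qed
    then show "z \<Turnstile> Box A" by (auto simp: z_def)
  qed
  have frag: "z \<Turnstile> A \<longleftrightarrow> y \<Turnstile> A" if "A \<in> S" for A
    using that
  proof (induct A)
    case (Var p)
    then show ?case using layer_equiv_atoms[OF prems(5) Var] by (auto simp: z_def V_def)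
  next
    case (Neg A)
    then show ?case using Neg_S[of A] by auto
  next
    case (Dis A B)
    then show ?case using Dis_S[of A B] by auto
  next
    case (Box A)
    then show ?case using Box_S' by blast
  next
    case (BBox D)
    show ?case
    proof (cases "desc x = {}")
      case True
      have "x \<Turnstile> BBox D \<longleftrightarrow> y \<Turnstile> BBox D" if "vars D \<inter> P = {}"
        using layer_equiv_atoms[OF prems(5) BBox.prems] that by simp
      then have "D \<in> R \<longleftrightarrow> y \<Turnstile> BBox D" using R[of D] BBox.prems by (simp add: R0_def)
      then show ?thesis using True leaf by (simp add: z_def)
    next
      case False
      then show ?thesis using leaf leaf_xy Box_S'[of D] BBox_S[OF BBox.prems] by simp
    qed
  qed auto
  have dflt: "default_outside controlled z"
    unfolding z_def
  proof (rule default_outside_Node)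
    show "default_outside controlled t" if "t \<in> set ts" for t
      using child[OF that] by (auto simp: amalgam_def)
    show "D \<in> R \<longleftrightarrow> Node V R ts \<Turnstile> D" if "ts = []" "D \<notin> controlled" for D
      using R[of D] that by simp
  qed
  \<comment> \<open>The condition is inherited from \<open>x\<close> for \<open>P\<close>-free
    \<open>D\<close>, from \<open>y\<close> if \<open>BBox D\<close> is in \<open>S\<close>, and
    holds by the leaf default otherwise.\<close>
  have "rosser z D" for D
  proof (cases "D \<in> controlled")
    case True
    then show ?thesis
    proof (elim CollectE disjE)
      assume "vars D \<inter> P = {}"
      then show ?thesis
        using good_rosser[OF prems(1), of D] free[of "Box D"] free[of "Box (BBox D)"]
          free[of "Box (Neg D)"] free[of "Box (Neg (BBox D))"]
        by (simp add: rosser_def del: sat.simps)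
    next
      assume "BBox D \<in> S"
      from BBox_S[OF this] show ?thesis
        using good_rosser[OF good_y, of D] frag[of "Box D"] frag[of "Box (BBox D)"]
          frag[of "Box (Neg D)"] frag[of "Box (Neg (BBox D))"]
        by (simp add: rosser_def del: sat.simps)
    qed
  qed (use default_outside_rosser[OF dflt] in blast)
  then have "good z" unfolding z_def
    using child by (intro good_Node) (auto simp: amalgam_def)
  then show ?case using free frag dflt unfolding amalgam_def by blast
qed

text \<open>\<open>GR_sound\<close> speaks only of nodes with a predecessor, so \<open>z\<close>
  needs a good root below it. The \<open>Suc\<close> in \<open>eq\<close> pays for matching the
  descendants of \<open>x\<close> above \<open>y\<close>.\<close>

lemma amalgamation_top:
  assumes "good s" "x \<in> desc s" "good s'" "y \<in> desc s'"
    and eq: "layer_equiv As (Suc (2 * card S)) x y"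
  obtains r z where "good r" "z \<in> desc r" "amalgam x y z"
proof -
  have "card (failing y) \<le> card S"
    by (rule card_inj_on_le[of Box]) (auto simp: failing_def inj_on_def finite_S)
  then have eq': "layer_equiv As (Suc (2 * card (failing y))) x y"
    using layer_equiv_mono[OF _ eq] by simp
  have "\<exists>z. amalgam x y z"
  proof (rule amalgamation)
    show "layer_equiv As (2 * card (failing y)) x y"
      using layer_equiv_mono[OF _ eq'] by simp
    show "\<exists>y1\<in>desc y. layer_equiv As (2 * card (failing y)) x1 y1" if "x1 \<in> desc x" for x1
      using layer_equiv_step[OF eq' that] by blast
  qed (use assms good_desc in auto)
  then obtain z where z: "amalgam x y z" by blast
  \<comment> \<open>With \<open>s\<close> and \<open>s'\<close> beside \<open>z\<close>, a
    \<open>D\<close> constant above the root is constant above both, which forces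
    \<open>BBox D\<close> at \<open>x\<close> and \<open>y\<close>. A leaf \<open>z\<close> copies
    one of these values or that of \<open>D\<close>.\<close>
  let ?r = "Node {} {} [z, s, s']"
  have good: "good t" if "t \<in> set [z, s, s']" for t
    using that z assms by (auto simp: amalgam_def)
  have inner: "desc s \<noteq> {}" "desc s' \<noteq> {}" using assms by auto
  have z_BBox: "(z \<Turnstile> BBox D \<longleftrightarrow> x \<Turnstile> BBox D) \<or> (z \<Turnstile> BBox D \<longleftrightarrow> y \<Turnstile> BBox D) \<or>
      (z \<Turnstile> BBox D \<longleftrightarrow> z \<Turnstile> D)" if "desc z = {}" for D
  proof -
    have "z \<Turnstile> BBox D \<longleftrightarrow> x \<Turnstile> BBox D" if "vars D \<inter> P = {}"
      using z that by (simp add: amalgam_def del: sat.simps)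
    moreover have "z \<Turnstile> BBox D \<longleftrightarrow> y \<Turnstile> BBox D" if "BBox D \<in> S"
      using z that unfolding amalgam_def by blast
    moreover have "z \<Turnstile> BBox D \<longleftrightarrow> z \<Turnstile> D" if "D \<notin> controlled"
      using z that \<open>desc z = {}\<close> unfolding amalgam_def default_outside_def by blast
    ultimately show ?thesis by blast
  qed
  have "rosser ?r D" for D
  proof (rule rosser_Node)
    fix t assume t: "t \<in> set [z, s, s']" "desc t = {}"
    then have tz: "t = z" using inner by auto
    note t = t(2)[unfolded tz]
    show "t \<Turnstile> BBox D" if D: "?r \<Turnstile> Box D"
    proof -
      have "s \<Turnstile> Box D" "s' \<Turnstile> Box D" "z \<Turnstile> D" using D by auto
      then have "s \<Turnstile> Box (BBox D)" "s' \<Turnstile> Box (BBox D)"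
        using good_rosser[OF assms(1)] good_rosser[OF assms(3)] unfolding rosser_def by blast+
      then have "x \<Turnstile> BBox D" "y \<Turnstile> BBox D" using assms(2,4) by (metis sat.simps(5))+
      then show ?thesis using z_BBox[OF t] \<open>z \<Turnstile> D\<close> tz by blast
    qed
    show "\<not> t \<Turnstile> BBox D" if D: "?r \<Turnstile> Box (Neg D)"
    proof -
      have "s \<Turnstile> Box (Neg D)" "s' \<Turnstile> Box (Neg D)" "\<not> z \<Turnstile> D" using D by auto
      then have "s \<Turnstile> Box (Neg (BBox D))" "s' \<Turnstile> Box (Neg (BBox D))"
        using good_rosser[OF assms(1)] good_rosser[OF assms(3)] unfolding rosser_def by blast+
      then have "\<not> x \<Turnstile> BBox D" "\<not> y \<Turnstile> BBox D" using assms(2,4) by (metis sat.simps(3,5))+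
      then show ?thesis using z_BBox[OF t] \<open>\<not> z \<Turnstile> D\<close> tz by blast
    qed
  qed (rule good)
  then have "good ?r" using good by (rule good_Node[rotated])
  then show thesis using that[of ?r z] z by simp
qed

end

section \<open>Uniform interpolation\<close>

definition disjunction :: "fm list \<Rightarrow> fm" where
  "disjunction As = foldr Dis As Bot"

lemma sat_disjunction: "t \<Turnstile> disjunction As \<longleftrightarrow> (\<exists>A\<in>set As. t \<Turnstile> A)"
  by (induct As) (auto simp: disjunction_def)

lemma vars_disjunction: "vars (disjunction As) = \<Union> (vars ` set As)"
  by (induct As) (auto simp: disjunction_def)

theorem theorem6p8:
  fixes A :: fm and P :: "nat set"
  assumes "finite P"
  shows "\<exists>C. vars C \<subseteq> vars A - P \<and>
             GR (Imp A C) \<and>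
             (\<forall>B. GR (Imp A B) \<and> vars B \<inter> P = {} \<longrightarrow> GR (Imp C B))"
proof -
  interpret fragment "closure A" by (rule fragment_closure)
  obtain As where As: "set As = {B \<in> closure A. vars B \<inter> P = {}}"
    using finite_list[of "{B \<in> closure A. vars B \<inter> P = {}}"] finite_S by auto
  interpret interpolation "closure A" P As by unfold_locales (rule As)
  let ?L = "layer As (Suc (2 * card (closure A)))"
  \<comment> \<open>Only nodes with a predecessor are searched, so by soundness and completeness
    these are the descriptions consistent with \<open>A\<close> in GR.\<close>
  define cs where "cs = filter (\<lambda>c. \<exists>s. good s \<and> (\<exists>y\<in>desc s. y \<Turnstile> A \<and> y \<Turnstile> c)) (descriptions ?L)"
  let ?C = "disjunction cs"
  have "vars c \<subseteq> vars A - P" if "c \<in> set cs" for c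
  proof -
    have "vars c \<subseteq> \<Union> (vars ` set ?L)"
      using that by (intro vars_descriptions) (simp add: cs_def del: layer.simps)
    also have "\<dots> \<subseteq> \<Union> (vars ` set As)" using vars_layer by blast
    also have "\<dots> \<subseteq> vars A - P" using As vars_closure by fastforce
    finally show ?thesis .
  qed
  then have "vars ?C \<subseteq> vars A - P" by (auto simp: vars_disjunction)
  moreover have "GR (Imp A ?C)"
  proof (rule GR_complete)
    fix s t assume s: "good s" "t \<in> desc s"
    obtain c where c: "c \<in> set (descriptions ?L)" "t \<Turnstile> c" using descriptions_complete by blast
    have "c \<in> set cs" if "t \<Turnstile> A" using c s that unfolding cs_def by (auto simp del: layer.simps)
    then show "t \<Turnstile> Imp A ?C" using c(2) by (auto simp: sat_disjunction)
  qed
  moreover have "GR (Imp ?C B)" if B: "GR (Imp A B)" "vars B \<inter> P = {}" for B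
  proof (rule GR_complete, rule ccontr)
    fix s x assume s: "good s" "x \<in> desc s" and "\<not> x \<Turnstile> Imp ?C B"
    then obtain c where c: "c \<in> set cs" "x \<Turnstile> c" and "\<not> x \<Turnstile> B" by (auto simp: sat_disjunction)
    then obtain s' y where y: "good s'" "y \<in> desc s'" "y \<Turnstile> A" "y \<Turnstile> c"
      and "c \<in> set (descriptions ?L)" unfolding cs_def by (auto simp del: layer.simps)
    \<comment> \<open>Both nodes satisfy the same description \<open>c\<close>, so they agree on the
      whole layer. The amalgam then takes \<open>A\<close> from \<open>y\<close> and the failure of
      \<open>B\<close> from \<open>x\<close>.\<close>
    then have "layer_equiv As (Suc (2 * card (closure A))) x y"
      using descriptions_determine[of c ?L x y] c(2) unfolding layer_equiv_def by blast
    from amalgamation_top[OF s y(1,2) this] obtain r z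
      where z: "good r" "z \<in> desc r" "amalgam x y z" by blast
    have "z \<Turnstile> A" using z(3) y(3) closure_refl unfolding amalgam_def by blast
    moreover have "\<not> z \<Turnstile> B" using z(3) \<open>\<not> x \<Turnstile> B\<close> B(2) unfolding amalgam_def by blast
    moreover have "z \<Turnstile> Imp A B" using GR_sound[OF B(1) z(1)] z(2) by simp
    ultimately show False by simp
  qed
  ultimately show ?thesis by blast
qed

end
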